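(* Fix $k\in[M]$, positive integers $L_P$ ($P\in\binom{[M]}{k}$) and a $\Gamma$-multiplicity constraint $\mathcal{M}_\Gamma$. The extreme points of the convex hull of the set of profile matrices of all simple $k$-dimensional $M$-part Sperner families on $X=X_1\uplus\cdots\uplus X_M$ with parameters $\{L_P\}$ satisfying $\mathcal{M}_\Gamma$ are exactly the profile matrices $S(I)$ of the homogeneous families corresponding to the simple $k$-dimensional transversals $I\subseteq\pi_M$ with parameters $\{L_P\}$ satisfying the same constraint $\mathcal{M}_\Gamma$. Therefore, among the maximum size simple $k$-dimensional $M$-part Sperner families with parameters $\{L_P\}$ satisfying $\mathcal{M}_\Gamma$ there are homogeneous ones.
   Context: $X$ is a finite set partitioned as $X=X_1\uplus\cdots\uplus X_M$, $|X_i|=m_i\ge1$, $n_i=m_i+1$, $[n]^{\star}=\{0,\ldots,n-1\}$, $\pi_M=\prod_i[n_i]^{\star}$. A simple family $\mathcal{F}$ of subsets of $X$ is a $k$-dimensional $M$-part Sperner family with parameters $\{L_P\}$ if for every $P\in\binom{[M]}{k}$, chains $\mathcal{C}_j$ of subsets of $X_j$ ($j\in P$) and sets $D_i\subseteq X_i$ ($i\notin P$), at most $L_P$ members $F$ satisfy $F\cap X_j\in\mathcal{C}_j$ ($j\in P$) and $F\cap X_i=D_i$ ($i\notin P$). A simple $k$-dimensional transversal with parameters $\{L_P\}$ is a set $I\subseteq\pi_M$ such that for every $P$ and fixed $b_j\in[n_j]^{\star}$ ($j\notin P$) at most $L_P$ elements of $I$ have $j$-th coordinate $b_j$ for all $j\notin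 P$. The profile vector of $F$ is $(|F\cap X_1|,\ldots,|F\cap X_M|)$; the profile matrix of a family has entry at $v\in\pi_M$ equal to the number of members with profile vector $v$. The homogeneous family corresponding to $I$ consists of all subsets of $X$ whose profile vector lies in $I$; its profile matrix is $S(I)$, with entry $\prod_j\binom{m_j}{i_j}$ at $(i_1,\ldots,i_M)\in I$ and $0$ elsewhere. A $\Gamma$-multiplicity constraint is $\mathcal{M}_\Gamma=\{(A_\gamma\ge0,\{\alpha^\gamma_v\ge0:v\in\pi_M\}):\gamma\in\Gamma\}$, $\Gamma$ finite; a family $\mathcal{F}$ satisfies it if $\sum_v\alpha^\gamma_v\max\{\#[F,\mathcal{F}]:F\text{ has profile vector }v\}\le A_\gamma$ for all $\gamma$ (where $\#[F,\mathcal{F}]\in\{0,1\}$ indicates membership), and a set $I\subseteq\pi_M$ satisfies it if $\sum_{v\in I}\alpha^\gamma_v\le A_\gamma$ for all $\gamma$. *)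

theory Defs
  imports "HOL-Analysis.Analysis" "HOL-Analysis.Finite_Function_Topology"
begin

text \<open>
  The parts are \<open>X 1, \<dots>, X M\<close>; the values of \<open>X\<close> outside \<open>{1..M}\<close> play no role. Profile
  vectors are functions on \<open>{1..M}\<close>, extended by \<open>undefined\<close> outside (as in \<open>PiE\<close>), so that
  they form a finite subset of \<open>nat \<Rightarrow> nat\<close>.
\<close>

definition ground :: "nat \<Rightarrow> (nat \<Rightarrow> 'a set) \<Rightarrow> 'a set" where
  "ground M X = (\<Union>i\<in>{1..M}. X i)"

definition parted :: "nat \<Rightarrow> (nat \<Rightarrow> 'a set) \<Rightarrow> bool" where
  "parted M X \<longleftrightarrow>
     disjoint_family_on X {1..M} \<and> (\<forall>i\<in>{1..M}. finite (X i) \<and> X i \<noteq> {})"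

definition profile_space :: "nat \<Rightarrow> (nat \<Rightarrow> 'a set) \<Rightarrow> (nat \<Rightarrow> nat) set" where
  "profile_space M X = (\<Pi>\<^sub>E i\<in>{1..M}. {0..<card (X i) + 1})"

definition profile :: "nat \<Rightarrow> (nat \<Rightarrow> 'a set) \<Rightarrow> 'a set \<Rightarrow> (nat \<Rightarrow> nat)" where
  "profile M X F = (\<lambda>i\<in>{1..M}. card (F \<inter> X i))"

text \<open>
  Matrices indexed by the profile space, a set depending on \<open>X\<close>, live in the real vector space
  of finitely supported functions from \<open>nat \<Rightarrow> nat\<close> to the reals; their entries outside the profile
  space are zero.
\<close>

definition profile_matrix ::
    "nat \<Rightarrow> (nat \<Rightarrow> 'a set) \<Rightarrow> 'a set set \<Rightarrow> ((nat \<Rightarrow> nat) \<Rightarrow>\<^sub>0 real)" where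
  "profile_matrix M X \<F> =
     (\<Sum>v\<in>profile_space M X.
        Poly_Mapping.single v (real (card {F \<in> \<F>. profile M X F = v})))"

definition sperner_family ::
    "nat \<Rightarrow> (nat \<Rightarrow> 'a set) \<Rightarrow> nat \<Rightarrow> (nat set \<Rightarrow> nat) \<Rightarrow> 'a set set \<Rightarrow> bool" where
  "sperner_family M X k L \<F> \<longleftrightarrow>
     \<F> \<subseteq> Pow (ground M X) \<and>
     (\<forall>P C D. P \<subseteq> {1..M} \<and> card P = k \<and>
        (\<forall>j\<in>P. subset.chain (Pow (X j)) (C j)) \<and>
        (\<forall>i\<in>{1..M} - P. D i \<subseteq> X i) \<longrightarrow>
        card {F \<in> \<F>. (\<forall>j\<in>P. F \<inter> X j \<in> C j) \<and> (\<forall>i\<in>{1..M} - P. F \<inter> X i = D i)} \<le> L P)"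

definition transversal ::
    "nat \<Rightarrow> (nat \<Rightarrow> 'a set) \<Rightarrow> nat \<Rightarrow> (nat set \<Rightarrow> nat) \<Rightarrow> (nat \<Rightarrow> nat) set \<Rightarrow> bool" where
  "transversal M X k L I \<longleftrightarrow>
     I \<subseteq> profile_space M X \<and>
     (\<forall>P b. P \<subseteq> {1..M} \<and> card P = k \<and>
        (\<forall>j\<in>{1..M} - P. b j \<in> {0..<card (X j) + 1}) \<longrightarrow>
        card {v \<in> I. \<forall>j\<in>{1..M} - P. v j = b j} \<le> L P)"

definition homogeneous_family ::
    "nat \<Rightarrow> (nat \<Rightarrow> 'a set) \<Rightarrow> (nat \<Rightarrow> nat) set \<Rightarrow> 'a set set" where
  "homogeneous_family M X I = {F \<in> Pow (ground M X). profile M X F \<in> I}"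

definition homogeneous :: "nat \<Rightarrow> (nat \<Rightarrow> 'a set) \<Rightarrow> 'a set set \<Rightarrow> bool" where
  "homogeneous M X \<F> \<longleftrightarrow> (\<exists>I\<subseteq>profile_space M X. \<F> = homogeneous_family M X I)"

text \<open>Multiplicity of \<open>F\<close> in a simple family.\<close>

definition mult :: "'a set \<Rightarrow> 'a set set \<Rightarrow> nat" where
  "mult F \<F> = (if F \<in> \<F> then 1 else 0)"

definition multiplicity_constraint ::
    "nat \<Rightarrow> (nat \<Rightarrow> 'a set) \<Rightarrow> 'g set \<Rightarrow> ('g \<Rightarrow> real) \<Rightarrow> ('g \<Rightarrow> (nat \<Rightarrow> nat) \<Rightarrow> real) \<Rightarrow> bool" where
  "multiplicity_constraint M X \<Gamma> A \<alpha> \<longleftrightarrow>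
     finite \<Gamma> \<and> (\<forall>\<gamma>\<in>\<Gamma>. A \<gamma> \<ge> 0 \<and> (\<forall>v\<in>profile_space M X. \<alpha> \<gamma> v \<ge> 0))"

definition family_satisfies ::
    "nat \<Rightarrow> (nat \<Rightarrow> 'a set) \<Rightarrow> 'g set \<Rightarrow> ('g \<Rightarrow> real) \<Rightarrow> ('g \<Rightarrow> (nat \<Rightarrow> nat) \<Rightarrow> real) \<Rightarrow>
      'a set set \<Rightarrow> bool" where
  "family_satisfies M X \<Gamma> A \<alpha> \<F> \<longleftrightarrow>
     (\<forall>\<gamma>\<in>\<Gamma>. (\<Sum>v\<in>profile_space M X.
        \<alpha> \<gamma> v * real (Max {mult F \<F> | F. F \<in> Pow (ground M X) \<and> profile M X F = v})) \<le> A \<gamma>)"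

definition index_set_satisfies ::
    "'g set \<Rightarrow> ('g \<Rightarrow> real) \<Rightarrow> ('g \<Rightarrow> (nat \<Rightarrow> nat) \<Rightarrow> real) \<Rightarrow> (nat \<Rightarrow> nat) set \<Rightarrow> bool" where
  "index_set_satisfies \<Gamma> A \<alpha> I \<longleftrightarrow> (\<forall>\<gamma>\<in>\<Gamma>. (\<Sum>v\<in>I. \<alpha> \<gamma> v) \<le> A \<gamma>)"

lemma finite_profile_space: "finite (profile_space M X)"
  unfolding profile_space_def by (intro finite_PiE) auto

lemma lookup_profile_matrix:
  "Poly_Mapping.lookup (profile_matrix M X \<F>) v =
     (if v \<in> profile_space M X then real (card {F \<in> \<F>. profile M X F = v}) else 0)"
  by (simp add: profile_matrix_def lookup_sum lookup_single when_def finite_profile_space)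

lemma card_profile_class:
  assumes "parted M X" and v: "v \<in> profile_space M X"
  shows "card {F \<in> Pow (ground M X). profile M X F = v} = (\<Prod>j\<in>{1..M}. card (X j) choose v j)"
proof -
  let ?B = "\<Pi>\<^sub>E j\<in>{1..M}. {A. A \<subseteq> X j \<and> card A = v j}"
  have dis: "disjoint_family_on X {1..M}" and fin: "\<And>i. i \<in> {1..M} \<Longrightarrow> finite (X i)"
    using assms(1) by (auto simp: parted_def)
  have part: "(\<Union>j\<in>{1..M}. g j) \<inter> X i = g i" if "g \<in> ?B" "i \<in> {1..M}" for g i
  proof -
    have sub: "g j \<subseteq> X j" if "j \<in> {1..M}" for j using PiE_mem[OF \<open>g \<in> ?B\<close> that] by auto
    have "g j \<inter> X i = {}" if "j \<in> {1..M}" "j \<noteq> i" for j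
      using disjoint_family_onD[OF dis that(1) \<open>i \<in> {1..M}\<close> that(2)] sub[OF that(1)] by blast
    then show ?thesis using sub[OF \<open>i \<in> {1..M}\<close>] \<open>i \<in> {1..M}\<close> by blast
  qed
  have "bij_betw (\<lambda>F. \<lambda>j\<in>{1..M}. F \<inter> X j) {F \<in> Pow (ground M X). profile M X F = v} ?B"
  proof (rule bij_betw_byWitness[where f' = "\<lambda>g. \<Union>j\<in>{1..M}. g j"])
    show "\<forall>F\<in>{F \<in> Pow (ground M X). profile M X F = v}.
        (\<Union>j\<in>{1..M}. (\<lambda>j\<in>{1..M}. F \<inter> X j) j) = F"
      by (auto simp: ground_def)
    show "\<forall>g\<in>?B. (\<lambda>j\<in>{1..M}. (\<Union>j\<in>{1..M}. g j) \<inter> X j) = g"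
    proof (intro ballI ext)
      fix g i assume "g \<in> ?B"
      show "(\<lambda>j\<in>{1..M}. (\<Union>j\<in>{1..M}. g j) \<inter> X j) i = g i"
      proof (cases "i \<in> {1..M}")
        case True
        then show ?thesis by (simp only: restrict_apply if_True part[OF \<open>g \<in> ?B\<close> True])
      next
        case False
        then show ?thesis
          using PiE_arb[OF \<open>g \<in> ?B\<close> False] by (simp only: restrict_apply if_False)
      qed
    qed
    show "(\<lambda>F. \<lambda>j\<in>{1..M}. F \<inter> X j) ` {F \<in> Pow (ground M X). profile M X F = v} \<subseteq> ?B"
    proof (intro image_subsetI restrict_PiE_iff[THEN iffD2] ballI CollectI conjI Int_lower2)
      fix F j assume "F \<in> {F \<in> Pow (ground M X). profile M X F = v}" "j \<in> {1..M}"
      then have "v j = profile M X F j" by (simp only: mem_Collect_eq)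
      also have "\<dots> = card (F \<inter> X j)"
        using \<open>j \<in> {1..M}\<close> unfolding profile_def by (simp only: restrict_apply if_True)
      finally show "card (F \<inter> X j) = v j" by (rule sym)
    qed
    show "(\<lambda>g. \<Union>j\<in>{1..M}. g j) ` ?B \<subseteq> {F \<in> Pow (ground M X). profile M X F = v}"
    proof (intro image_subsetI CollectI conjI)
      fix g assume g: "g \<in> ?B"
      have mem: "g j \<subseteq> X j \<and> card (g j) = v j" if "j \<in> {1..M}" for j
        using PiE_mem[OF g that] by auto
      show "(\<Union>j\<in>{1..M}. g j) \<in> Pow (ground M X)" using mem unfolding ground_def by blast
      show "profile M X (\<Union>j\<in>{1..M}. g j) = v"
      proof
        fix i
        show "profile M X (\<Union>j\<in>{1..M}. g j) i = v i"
        proof (cases "i \<in> {1..M}")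
          case True
          then show ?thesis unfolding profile_def by (simp only: restrict_apply if_True part[OF g True] mem[OF True])
        next
          case False
          then have "v i = undefined" by (rule PiE_arb[OF v[unfolded profile_space_def]])
          with False show ?thesis unfolding profile_def by (simp only: restrict_apply if_False)
        qed
      qed
    qed
  qed
  then have "card {F \<in> Pow (ground M X). profile M X F = v} = card ?B"
    by (rule bij_betw_same_card)
  also have "\<dots> = (\<Prod>j\<in>{1..M}. card {A. A \<subseteq> X j \<and> card A = v j})"
    by (simp add: card_PiE)
  also have "\<dots> = (\<Prod>j\<in>{1..M}. card (X j) choose v j)"
    by (intro prod.cong refl) (simp only: n_subsets[OF fin])
  finally show ?thesis .
qed

text \<open>The entries of \<open>S(I)\<close>, the profile matrix of the homogeneous family corresponding to \<open>I\<close>.\<close>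

lemma lookup_profile_matrix_homogeneous_family:
  assumes "parted M X" and "I \<subseteq> profile_space M X"
  shows "Poly_Mapping.lookup (profile_matrix M X (homogeneous_family M X I)) v =
     (if v \<in> I then real (\<Prod>j\<in>{1..M}. card (X j) choose v j) else 0)"
proof -
  have "{F \<in> homogeneous_family M X I. profile M X F = v} =
      (if v \<in> I then {F \<in> Pow (ground M X). profile M X F = v} else {})"
    by (auto simp: homogeneous_family_def)
  then show ?thesis
    using assms(2) card_profile_class[OF assms(1)] by (auto simp: lookup_profile_matrix)
qed

end

theory Submission
  imports Defs "HOL-Combinatorics.Permutations"
begin

text \<open>
  Fix a product of full chains, one in every part. A permutation \<open>\<sigma>\<close> of the ground set that
  preserves the parts moves it to another such product, on which a Sperner family \<open>\<F>\<close> traces out a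
  transversal \<open>I \<sigma>\<close>. Since these permutations act transitively on the sets of a given profile,
  double counting shows that the profile matrix of \<open>\<F>\<close> is the average of the \<open>S(I \<sigma>)\<close>, so both
  kinds of matrices have the same convex hull. All of them lie in a box of which the \<open>S(I)\<close> are
  vertices, hence the \<open>S(I)\<close> are extreme. The size of a family is a linear functional of its profile
  matrix and therefore attains its maximum at some \<open>S(I)\<close>.
\<close>

section \<open>Convex sets and segments of finitely supported functions\<close>

lemma lookup_scaleR:
  fixes x :: "'b \<Rightarrow>\<^sub>0 'c::real_vector"
  shows "Poly_Mapping.lookup (r *\<^sub>R x) v = r *\<^sub>R Poly_Mapping.lookup x v"
proof -
  have "finite {i. r *\<^sub>R Poly_Mapping.lookup x i \<noteq> 0}"
    by (rule finite_subset[OF _ finite_lookup[of x]]) auto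
  then show ?thesis by (simp add: scaleR_poly_mapping_def)
qed

text \<open>An endpoint of a real interval is a proper convex combination of two points of the
  interval only if both equal it. Applied in every coordinate this forces \<open>a = b\<close>,
  whereas an open segment has distinct ends.\<close>

lemma box_vertex_not_in_open_segment:
  fixes x a b :: "'b \<Rightarrow>\<^sub>0 real"
  assumes box: "\<And>y v. y \<in> {a, b} \<Longrightarrow> Poly_Mapping.lookup y v \<in> {0..c v}"
    and vertex: "\<And>v. Poly_Mapping.lookup x v \<in> {0, c v}"
  shows "x \<notin> open_segment a b"
proof
  assume "x \<in> open_segment a b"
  then obtain u where u: "0 < u" "u < 1" "a \<noteq> b" and x: "x = (1 - u) *\<^sub>R a + u *\<^sub>R b"
    by (auto simp: in_segment)
  have "Poly_Mapping.lookup a v = Poly_Mapping.lookup b v" for v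
  proof -
    let ?a = "Poly_Mapping.lookup a v" and ?b = "Poly_Mapping.lookup b v"
    have eq: "Poly_Mapping.lookup x v = (1 - u) * ?a + u * ?b"
      by (simp add: x lookup_add lookup_scaleR)
    have ab: "0 \<le> ?a" "?a \<le> c v" "0 \<le> ?b" "?b \<le> c v" using box[of a v] box[of b v] by auto
    \<comment> \<open>At the upper end, the distance to \<open>c v\<close> is the same convex
      combination of the distances of \<open>?a\<close> and \<open>?b\<close>. So in both cases two
      nonnegative terms with positive weights sum to zero.\<close>
    consider "(1 - u) * ?a + u * ?b = 0" | "(1 - u) * (c v - ?a) + u * (c v - ?b) = 0"
      using vertex[of v] by (auto simp: eq algebra_simps)
    then show ?thesis
    proof cases
      case 1
      then have "(1 - u) * ?a = 0 \<and> u * ?b = 0"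
        by (subst (asm) add_nonneg_eq_0_iff) (use u ab in auto)
      then show ?thesis using u by auto
    next
      case 2
      then have "(1 - u) * (c v - ?a) = 0 \<and> u * (c v - ?b) = 0"
        by (subst (asm) add_nonneg_eq_0_iff) (use u ab in auto)
      then show ?thesis using u by auto
    qed
  qed
  then show False using \<open>a \<noteq> b\<close> poly_mapping_eqI by blast
qed

text \<open>Lets coordinatewise bounds pass from a set of generators to its convex hull.\<close>

lemma convex_lookup_box: "convex {x :: 'b \<Rightarrow>\<^sub>0 real. \<forall>v. Poly_Mapping.lookup x v \<in> {0..c v}}"
proof (rule convexI)
  fix x y :: "'b \<Rightarrow>\<^sub>0 real" and u w :: real
  assume "x \<in> {x. \<forall>v. Poly_Mapping.lookup x v \<in> {0..c v}}"
    and "y \<in> {x. \<forall>v. Poly_Mapping.lookup x v \<in> {0..c v}}"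
    and u: "0 \<le> u" "0 \<le> w" "u + w = 1"
  then have "u *\<^sub>R Poly_Mapping.lookup x v + w *\<^sub>R Poly_Mapping.lookup y v \<in> {0..c v}" for v
    by (intro convexD[OF convex_real_interval(5)]) auto
  then show "u *\<^sub>R x + w *\<^sub>R y \<in> {x. \<forall>v. Poly_Mapping.lookup x v \<in> {0..c v}}"
    by (simp add: lookup_add lookup_scaleR)
qed

text \<open>A half-space of a linear functional. With \<open>V\<close> the profile space the
  functional gives the size of a family, so a bound on sizes extends to the hull.\<close>

lemma convex_sum_lookup_le:
  "convex {x :: 'b \<Rightarrow>\<^sub>0 real. (\<Sum>v\<in>V. Poly_Mapping.lookup x v) \<le> c}"
proof (rule convexI)
  fix x y :: "'b \<Rightarrow>\<^sub>0 real" and u w :: real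
  assume xy: "x \<in> {x. (\<Sum>v\<in>V. Poly_Mapping.lookup x v) \<le> c}"
    "y \<in> {x. (\<Sum>v\<in>V. Poly_Mapping.lookup x v) \<le> c}"
    and u: "0 \<le> u" "0 \<le> w" "u + w = 1"
  have "(\<Sum>v\<in>V. Poly_Mapping.lookup (u *\<^sub>R x + w *\<^sub>R y) v) =
      u * (\<Sum>v\<in>V. Poly_Mapping.lookup x v) + w * (\<Sum>v\<in>V. Poly_Mapping.lookup y v)"
    by (simp add: lookup_add lookup_scaleR sum.distrib sum_distrib_left)
  also have "\<dots> \<le> c"
    using xy u by (intro convex_bound_le) auto
  finally show "u *\<^sub>R x + w *\<^sub>R y \<in> {x. (\<Sum>v\<in>V. Poly_Mapping.lookup x v) \<le> c}" by simp
qed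

section \<open>Full chains, traces on the parts and profiles\<close>

lemma full_chain_exists:
  assumes "finite S"
  obtains c :: "nat \<Rightarrow> 'b set" where "\<And>t. c t \<subseteq> S"
    and "\<And>t. t \<le> card S \<Longrightarrow> card (c t) = t" and "\<And>s t. s \<le> t \<Longrightarrow> c s \<subseteq> c t"
proof -
  obtain h where h: "bij_betw h {0..<card S} S"
    using ex_bij_betw_nat_finite[OF assms] by blast
  \<comment> \<open>The chain consists of the initial segments of an enumeration of
    \<open>S\<close>. Truncation at \<open>card S\<close> makes it constant from there on, so
    containment and monotonicity hold for every natural index.\<close>
  let ?c = "\<lambda>t. h ` {0..<min t (card S)}"
  have inj: "inj_on h {0..<min t (card S)}" for t
    by (rule inj_on_subset[OF bij_betw_imp_inj_on[OF h]]) auto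
  show thesis
  proof (rule that)
    show "?c t \<subseteq> S" for t using bij_betw_imp_surj_on[OF h] by auto
    show "card (?c t) = t" if "t \<le> card S" for t
      using that card_image[OF inj[of t]] by simp
    show "?c s \<subseteq> ?c t" if "s \<le> t" for s t using that by (intro image_mono) auto
  qed
qed

lemma finite_ground: "parted M X \<Longrightarrow> finite (ground M X)"
  by (auto simp: parted_def ground_def)

lemma part_subset_ground: "i \<in> {1..M} \<Longrightarrow> X i \<subseteq> ground M X"
  unfolding ground_def by blast

lemma profile_in_profile_space:
  assumes "parted M X"
  shows "profile M X F \<in> profile_space M X"
  using assms unfolding profile_space_def profile_def parted_def
  by (auto simp: less_Suc_eq_le intro!: card_mono)

lemma profile_apply: "i \<in> {1..M} \<Longrightarrow> profile M X F i = card (F \<inter> X i)"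
  by (simp add: profile_def)

lemma ground_subset_eqI:
  assumes "F \<subseteq> ground M X" "E \<subseteq> ground M X" "\<And>i. i \<in> {1..M} \<Longrightarrow> F \<inter> X i = E \<inter> X i"
  shows "F = E"
  using assms unfolding ground_def by blast

subsection \<open>Permutations preserving the parts\<close>

text \<open>For disjoint parts this is the direct product of their symmetric groups, a Young
  subgroup. Since \<open>permutes\<close> fixes all points outside the ground set, a finite ground
  set gives a finite group.\<close>

definition part_perms :: "nat \<Rightarrow> (nat \<Rightarrow> 'a set) \<Rightarrow> ('a \<Rightarrow> 'a) set" where
  "part_perms M X = {\<sigma>. \<sigma> permutes ground M X \<and> (\<forall>i\<in>{1..M}. \<sigma> ` X i = X i)}"

lemma finite_part_perms: "parted M X \<Longrightarrow> finite (part_perms M X)"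
  unfolding part_perms_def
  by (rule finite_subset[OF _ finite_permutations[OF finite_ground]]) auto

lemma id_in_part_perms: "id \<in> part_perms M X"
  by (simp add: part_perms_def permutes_id)

lemma part_perms_inj: "\<sigma> \<in> part_perms M X \<Longrightarrow> inj \<sigma>"
  by (auto simp: part_perms_def intro: permutes_inj)

lemma part_perms_image_Int:
  assumes "\<sigma> \<in> part_perms M X" "i \<in> {1..M}"
  shows "\<sigma> ` F \<inter> X i = \<sigma> ` (F \<inter> X i)"
  using assms image_Int[OF part_perms_inj[OF assms(1)], of F "X i"] by (simp add: part_perms_def)

lemma part_perms_image_ground:
  assumes "\<sigma> \<in> part_perms M X" "F \<subseteq> ground M X"
  shows "\<sigma> ` F \<subseteq> ground M X"
  using assms permutes_image[of \<sigma> "ground M X"] by (auto simp: part_perms_def)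

lemma part_perms_profile:
  assumes "\<sigma> \<in> part_perms M X"
  shows "profile M X (\<sigma> ` F) = profile M X F"
  unfolding profile_def
  using part_perms_image_Int[OF assms] card_image[OF inj_on_subset[OF part_perms_inj[OF assms]]]
  by (intro restrict_ext) simp

lemma part_perms_comp:
  "\<sigma> \<in> part_perms M X \<Longrightarrow> \<tau> \<in> part_perms M X \<Longrightarrow> \<sigma> \<circ> \<tau> \<in> part_perms M X"
  unfolding part_perms_def
  by (simp only: mem_Collect_eq permutes_compose image_comp[symmetric]) blast

text \<open>The complements in \<open>S\<close> also have equal size, so a bijection from
  \<open>A\<close> to \<open>B\<close> and one between the complements can be glued.\<close>

lemma bij_betw_mapping_subset:
  assumes "finite S" "A \<subseteq> S" "B \<subseteq> S" "card A = card B"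
  obtains f where "bij_betw f S S" "f ` A = B"
proof -
  have fin: "finite A" "finite B" "finite (S - A)" "finite (S - B)"
    using assms by (auto intro: finite_subset)
  obtain g where g: "bij_betw g A B"
    using finite_same_card_bij[OF fin(1,2) assms(4)] by blast
  have "card (S - A) = card (S - B)" using assms fin by (simp add: card_Diff_subset)
  then obtain h where h: "bij_betw h (S - A) (S - B)"
    using finite_same_card_bij[OF fin(3,4)] by blast
  let ?f = "\<lambda>x. if x \<in> A then g x else h x"
  have "bij_betw ?f (A \<union> (S - A)) (B \<union> (S - B))"
    by (rule bij_betw_disjoint_Un[OF g h]) auto
  moreover have "A \<union> (S - A) = S" "B \<union> (S - B) = S" using assms by auto
  ultimately have "bij_betw ?f S S" by simp
  moreover have "?f ` A = B" using bij_betw_imp_surj_on[OF g] by auto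
  ultimately show thesis by (rule that)
qed

text \<open>In each part the two traces have equal size, so a permutation of the part carries one to
  the other. As the parts are disjoint, these permutations glue to one of the ground set.\<close>

lemma part_perms_transitive:
  assumes par: "parted M X" and E: "E \<subseteq> ground M X" and F: "F \<subseteq> ground M X"
    and eq: "profile M X E = profile M X F"
  obtains \<tau> where "\<tau> \<in> part_perms M X" "\<tau> ` E = F"
proof -
  have dis: "disjoint_family_on X {1..M}" and fin: "\<And>i. i \<in> {1..M} \<Longrightarrow> finite (X i)"
    using par by (auto simp: parted_def)
  have "\<exists>f. bij_betw f (X i) (X i) \<and> f ` (E \<inter> X i) = F \<inter> X i" if "i \<in> {1..M}" for i
  proof -
    have "card (E \<inter> X i) = card (F \<inter> X i)"
      using profile_apply[OF that, of X E] profile_apply[OF that, of X F] eq by simp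
    then show ?thesis
      by (rule bij_betw_mapping_subset[OF fin[OF that] Int_lower2 Int_lower2]) blast
  qed
  then obtain f where f: "bij_betw (f i) (X i) (X i)" "f i ` (E \<inter> X i) = F \<inter> X i"
    if "i \<in> {1..M}" for i
    by metis
  define part where "part x = (THE i. i \<in> {1..M} \<and> x \<in> X i)" for x
  have part: "part x = i" if "i \<in> {1..M}" "x \<in> X i" for x i
    unfolding part_def
  proof (rule the_equality)
    show "j = i" if "j \<in> {1..M} \<and> x \<in> X j" for j
      using disjoint_family_onD[OF dis, of j i] that \<open>i \<in> {1..M}\<close> \<open>x \<in> X i\<close> by blast
  qed (use that in simp)
  define \<tau> where "\<tau> x = (if x \<in> ground M X then f (part x) x else x)" for x
  have tau: "\<tau> x = f i x" if "i \<in> {1..M}" "x \<in> X i" for x i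
    using that part[OF that] part_subset_ground[OF that(1), of X] by (auto simp: \<tau>_def)
  have bij: "bij_betw \<tau> (X i) (X i)" if "i \<in> {1..M}" for i
    using f(1)[OF that] by (subst bij_betw_cong[OF tau[OF that]])
  have "bij_betw \<tau> (ground M X) (ground M X)"
    unfolding ground_def by (rule bij_betw_UNION_disjoint[OF dis bij])
  then have "\<tau> permutes ground M X" by (rule bij_imp_permutes) (simp add: \<tau>_def)
  then have G: "\<tau> \<in> part_perms M X"
    unfolding part_perms_def using bij_betw_imp_surj_on[OF bij] by blast
  moreover have "\<tau> ` E = F"
  proof (rule ground_subset_eqI[OF part_perms_image_ground[OF G E] F])
    fix i assume i: "i \<in> {1..M}"
    have "\<tau> ` E \<inter> X i = \<tau> ` (E \<inter> X i)" by (rule part_perms_image_Int[OF G i])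
    also have "\<dots> = f i ` (E \<inter> X i)" using tau[OF i] by (intro image_cong) auto
    finally show "\<tau> ` E \<inter> X i = F \<inter> X i" using f(2)[OF i] by simp
  qed
  ultimately show thesis by (rule that)
qed

text \<open>The permutations taking \<open>E\<close> to \<open>F\<close> form a coset of the
  stabiliser of \<open>E\<close>. Concretely, composition with a permutation taking one target to
  the other injects one fibre into the other, and transitivity supplies such permutations both
  ways.\<close>

lemma card_part_perms_fibre:
  assumes par: "parted M X" and E: "E \<subseteq> ground M X" and F: "F \<subseteq> ground M X"
    and eq: "profile M X E = profile M X F"
  shows "card {\<sigma> \<in> part_perms M X. \<sigma> ` E = F} = card {\<sigma> \<in> part_perms M X. \<sigma> ` E = E}"
proof (rule antisym)
  have le: "card {\<sigma> \<in> part_perms M X. \<sigma> ` E = A} \<le> card {\<sigma> \<in> part_perms M X. \<sigma> ` E = B}"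
    if \<tau>: "\<tau> \<in> part_perms M X" "\<tau> ` A = B" for \<tau> A B
  proof (rule card_inj_on_le[where f = "(\<circ>) \<tau>"])
    show "inj_on ((\<circ>) \<tau>) {\<sigma> \<in> part_perms M X. \<sigma> ` E = A}"
      by (rule inj_on_subset[OF fun.inj_map[OF part_perms_inj[OF \<tau>(1)]]]) simp
    show "(\<circ>) \<tau> ` {\<sigma> \<in> part_perms M X. \<sigma> ` E = A} \<subseteq> {\<sigma> \<in> part_perms M X. \<sigma> ` E = B}"
      using part_perms_comp[OF \<tau>(1)] \<tau>(2) by (auto simp: image_comp[symmetric])
    show "finite {\<sigma> \<in> part_perms M X. \<sigma> ` E = B}" using finite_part_perms[OF par] by simp
  qed
  obtain \<tau> where "\<tau> \<in> part_perms M X" "\<tau> ` E = F"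
    using part_perms_transitive[OF par E F eq] by blast
  then show "card {\<sigma> \<in> part_perms M X. \<sigma> ` E = E} \<le> card {\<sigma> \<in> part_perms M X. \<sigma> ` E = F}"
    by (rule le)
  obtain \<tau> where "\<tau> \<in> part_perms M X" "\<tau> ` F = E"
    using part_perms_transitive[OF par F E eq[symmetric]] by blast
  then show "card {\<sigma> \<in> part_perms M X. \<sigma> ` E = F} \<le> card {\<sigma> \<in> part_perms M X. \<sigma> ` E = E}"
    by (rule le)
qed

text \<open>Sort the permutations by the image of \<open>E\<close>. The image keeps the profile of
  \<open>E\<close>, so it ranges over one profile class, and each member of that class is reached
  equally often.\<close>

lemma card_part_perms_hitting:
  assumes par: "parted M X" and E: "E \<subseteq> ground M X" and \<F>: "\<F> \<subseteq> Pow (ground M X)"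
  shows "card {\<sigma> \<in> part_perms M X. \<sigma> ` E \<in> \<F>} =
    card {F \<in> \<F>. profile M X F = profile M X E} * card {\<sigma> \<in> part_perms M X. \<sigma> ` E = E}"
proof -
  let ?C = "{F \<in> \<F>. profile M X F = profile M X E}"
  have fin: "finite ?C"
    using finite_subset[OF \<F>] finite_ground[OF par] by simp
  have "{\<sigma> \<in> part_perms M X. \<sigma> ` E \<in> \<F>} = (\<Union>F\<in>?C. {\<sigma> \<in> part_perms M X. \<sigma> ` E = F})"
    using part_perms_profile by blast
  also have "card \<dots> = (\<Sum>F\<in>?C. card {\<sigma> \<in> part_perms M X. \<sigma> ` E = F})"
    using fin finite_part_perms[OF par] by (intro card_UN_disjoint) auto
  also have "\<dots> = (\<Sum>F\<in>?C. card {\<sigma> \<in> part_perms M X. \<sigma> ` E = E})"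
    using \<F> by (intro sum.cong refl card_part_perms_fibre[OF par E]) auto
  finally show ?thesis by simp
qed

text \<open>The fraction of permutations carrying \<open>E\<close> into \<open>\<F>\<close> equals
  the fraction of the profile class of \<open>E\<close> that lies in \<open>\<F>\<close>, written
  without division.\<close>

lemma card_hitting_ratio:
  assumes par: "parted M X" and E: "E \<subseteq> ground M X" and \<F>: "\<F> \<subseteq> Pow (ground M X)"
  shows "real (card {\<sigma> \<in> part_perms M X. \<sigma> ` E \<in> \<F>}) *
      real (\<Prod>j\<in>{1..M}. card (X j) choose profile M X E j) =
    real (card (part_perms M X)) * real (card {F \<in> \<F>. profile M X F = profile M X E})"
proof -
  \<comment> \<open>With the full power set as the family, the hitting count becomes the
    orbit-stabiliser formula. It serves to eliminate the order of the stabiliser.\<close>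
  have "{\<sigma> \<in> part_perms M X. \<sigma> ` E \<in> Pow (ground M X)} = part_perms M X"
    using part_perms_image_ground[OF _ E] by blast
  then have "card (part_perms M X) =
      card {F \<in> Pow (ground M X). profile M X F = profile M X E} *
      card {\<sigma> \<in> part_perms M X. \<sigma> ` E = E}"
    using card_part_perms_hitting[OF par E order_refl] by simp
  then show ?thesis
    unfolding card_profile_class[OF par profile_in_profile_space[OF par]]
    using card_part_perms_hitting[OF par E \<F>] by (simp only: of_nat_mult mult_ac)
qed

subsection \<open>Products of full chains\<close>

text \<open>\<open>E v\<close> is the union of the chain members \<open>c i (v i)\<close>. The
  profile equation is confined to the profile space because each chain stops growing once it fills
  its part.\<close>

lemma product_chain_exists:
  assumes par: "parted M X"
  obtains c :: "nat \<Rightarrow> nat \<Rightarrow> 'a set" and E :: "(nat \<Rightarrow> nat) \<Rightarrow> 'a set"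
  where "\<And>i s t. i \<in> {1..M} \<Longrightarrow> s \<le> t \<Longrightarrow> c i s \<subseteq> c i t"
    and "\<And>i t. i \<in> {1..M} \<Longrightarrow> c i t \<subseteq> X i"
    and "\<And>v i. i \<in> {1..M} \<Longrightarrow> E v \<inter> X i = c i (v i)"
    and "\<And>v. E v \<subseteq> ground M X"
    and "\<And>v. v \<in> profile_space M X \<Longrightarrow> profile M X (E v) = v"
proof -
  have dis: "disjoint_family_on X {1..M}" and fin: "\<And>i. i \<in> {1..M} \<Longrightarrow> finite (X i)"
    using par by (auto simp: parted_def)
  have "\<exists>c. (\<forall>t. c t \<subseteq> X i) \<and> (\<forall>t. t \<le> card (X i) \<longrightarrow> card (c t) = t) \<and>
      (\<forall>s t. s \<le> t \<longrightarrow> c s \<subseteq> c t)" if "i \<in> {1..M}" for i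
    using full_chain_exists[OF fin[OF that]] by metis
  then obtain c where sub: "\<And>i t. i \<in> {1..M} \<Longrightarrow> c i t \<subseteq> X i"
    and card: "\<And>i t. i \<in> {1..M} \<Longrightarrow> t \<le> card (X i) \<Longrightarrow> card (c i t) = t"
    and mono: "\<And>i s t. i \<in> {1..M} \<Longrightarrow> s \<le> t \<Longrightarrow> c i s \<subseteq> c i t"
    by metis
  let ?E = "\<lambda>v. \<Union>j\<in>{1..M}. c j (v j)"
  have Int: "?E v \<inter> X i = c i (v i)" if "i \<in> {1..M}" for v i
  proof -
    have "c j (v j) \<inter> X i = {}" if "j \<in> {1..M}" "j \<noteq> i" for j
      using disjoint_family_onD[OF dis that(1) \<open>i \<in> {1..M}\<close> that(2)] sub[OF that(1)] by blast
    then show ?thesis using sub[OF that] that by blast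
  qed
  show thesis
  proof (rule that[OF mono sub Int])
    show "?E v \<subseteq> ground M X" for v using sub unfolding ground_def by blast
    show "profile M X (?E v) = v" if v: "v \<in> profile_space M X" for v
    proof
      fix i
      show "profile M X (?E v) i = v i"
      proof (cases "i \<in> {1..M}")
        case True
        have "v i \<le> card (X i)"
          using PiE_mem[OF v[unfolded profile_space_def] True] by simp
        then show ?thesis using card[OF True] profile_apply[OF True] Int[OF True] by metis
      next
        case False
        then show ?thesis
          using PiE_arb[OF v[unfolded profile_space_def] False]
          unfolding profile_def by (simp only: restrict_apply if_False)
      qed
    qed
  qed
qed

lemma profile_class_nonempty:
  assumes "parted M X" "v \<in> profile_space M X"
  obtains F where "F \<in> Pow (ground M X)" "profile M X F = v"
  using product_chain_exists[OF assms(1)] assms(2) by (metis PowI)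

lemma trace_transversal:
  assumes par: "parted M X" and sp: "sperner_family M X k L \<F>" and \<sigma>: "\<sigma> \<in> part_perms M X"
    and mono: "\<And>i s t. i \<in> {1..M} \<Longrightarrow> s \<le> t \<Longrightarrow> c i s \<subseteq> c i t"
    and sub: "\<And>i t. i \<in> {1..M} \<Longrightarrow> c i t \<subseteq> X i"
    and Int: "\<And>v i. i \<in> {1..M} \<Longrightarrow> E v \<inter> X i = c i (v i)"
    and prof: "\<And>v. v \<in> profile_space M X \<Longrightarrow> profile M X (E v) = v"
  shows "transversal M X k L {v \<in> profile_space M X. \<sigma> ` E v \<in> \<F>}"
  unfolding transversal_def
proof (intro conjI allI impI)
  fix P b
  assume P: "P \<subseteq> {1..M} \<and> card P = k \<and> (\<forall>j\<in>{1..M} - P. b j \<in> {0..<card (X j) + 1})"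
  let ?I = "{v \<in> profile_space M X. \<sigma> ` E v \<in> \<F>}"
  \<comment> \<open>Instances for the Sperner condition: the moved chains in the parts of
    \<open>P\<close>, and the moved chain members at the fixed coordinates \<open>b\<close>
    elsewhere.\<close>
  define C where "C j = range (\<lambda>t. \<sigma> ` c j t)" for j
  define D where "D j = \<sigma> ` c j (b j)" for j
  have \<F>: "\<F> \<subseteq> Pow (ground M X)" using sp by (simp add: sperner_family_def)
  have im: "\<sigma> ` c i t \<subseteq> X i" if "i \<in> {1..M}" for i t
    using image_mono[OF sub[OF that], of \<sigma> t] \<sigma> that by (simp add: part_perms_def)
  have chain: "subset.chain (Pow (X j)) (C j)" if "j \<in> {1..M}" for j
    unfolding subset_chain_def
  proof (intro conjI ballI)
    show "C j \<subseteq> Pow (X j)" using im[OF that] by (auto simp: C_def)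
    fix A B assume "A \<in> C j" "B \<in> C j"
    then obtain s t where "A = \<sigma> ` c j s" "B = \<sigma> ` c j t" by (auto simp: C_def)
    then show "A \<subseteq> B \<or> B \<subseteq> A"
      using mono[OF that, of s t] mono[OF that, of t s] by (metis image_mono linear)
  qed
  let ?H = "{F \<in> \<F>. (\<forall>j\<in>P. F \<inter> X j \<in> C j) \<and> (\<forall>i\<in>{1..M} - P. F \<inter> X i = D i)}"
  have sInt: "\<sigma> ` E v \<inter> X i = \<sigma> ` c i (v i)" if "i \<in> {1..M}" for v i
    using part_perms_image_Int[OF \<sigma> that] Int[OF that] by simp
  have "card {v \<in> ?I. \<forall>j\<in>{1..M} - P. v j = b j} \<le> card ?H"
  proof (rule card_inj_on_le[where f = "\<lambda>v. \<sigma> ` E v"])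
    show "inj_on (\<lambda>v. \<sigma> ` E v) {v \<in> ?I. \<forall>j\<in>{1..M} - P. v j = b j}"
    proof (rule inj_on_inverseI[where g = "profile M X"])
      show "profile M X (\<sigma> ` E v) = v" if "v \<in> {v \<in> ?I. \<forall>j\<in>{1..M} - P. v j = b j}" for v
        using that part_perms_profile[OF \<sigma>] prof by simp
    qed
    show "(\<lambda>v. \<sigma> ` E v) ` {v \<in> ?I. \<forall>j\<in>{1..M} - P. v j = b j} \<subseteq> ?H"
    proof (intro image_subsetI CollectI conjI ballI)
      fix v assume v: "v \<in> {v \<in> ?I. \<forall>j\<in>{1..M} - P. v j = b j}"
      then show "\<sigma> ` E v \<in> \<F>" by blast
      show "\<sigma> ` E v \<inter> X j \<in> C j" if "j \<in> P" for j
        using sInt[of j v] P that unfolding C_def by blast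
      show "\<sigma> ` E v \<inter> X i = D i" if "i \<in> {1..M} - P" for i
        using sInt[of i v] v that unfolding D_def by simp
    qed
    show "finite ?H" using finite_subset[OF \<F>] finite_ground[OF par] by simp
  qed
  also have "card ?H \<le> L P"
  proof -
    have "(\<forall>j\<in>P. subset.chain (Pow (X j)) (C j)) \<and> (\<forall>i\<in>{1..M} - P. D i \<subseteq> X i)"
      using P chain im by (auto simp: D_def)
    then show ?thesis using sp P unfolding sperner_family_def by blast
  qed
  finally show "card {v \<in> ?I. \<forall>j\<in>{1..M} - P. v j = b j} \<le> L P" .
qed simp

subsection \<open>Homogeneous families\<close>

text \<open>No index is lost, because every vector of the profile space is the profile of some
  set.\<close>

lemma profile_image_homogeneous_family:
  assumes "parted M X" "I \<subseteq> profile_space M X"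
  shows "profile M X ` homogeneous_family M X I = I"
proof
  show "I \<subseteq> profile M X ` homogeneous_family M X I"
  proof
    fix v assume "v \<in> I"
    moreover obtain F where "F \<in> Pow (ground M X)" "profile M X F = v"
      using profile_class_nonempty[OF assms(1)] assms(2) \<open>v \<in> I\<close> by blast
    ultimately show "v \<in> profile M X ` homogeneous_family M X I"
      by (auto simp: homogeneous_family_def)
  qed
qed (auto simp: homogeneous_family_def)

text \<open>A member of the homogeneous family with prescribed traces off \<open>P\<close> is determined by the sizes of
  its traces in the chains, that is, by its profile.\<close>

lemma homogeneous_family_sperner:
  assumes par: "parted M X" and tr: "transversal M X k L I"
  shows "sperner_family M X k L (homogeneous_family M X I)"
  unfolding sperner_family_def
proof (intro conjI allI impI)
  have I: "I \<subseteq> profile_space M X" using tr by (simp add: transversal_def)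
  have fin: "\<And>i. i \<in> {1..M} \<Longrightarrow> finite (X i)" using par by (auto simp: parted_def)
  show "homogeneous_family M X I \<subseteq> Pow (ground M X)" by (auto simp: homogeneous_family_def)
  fix P C D
  assume P: "P \<subseteq> {1..M} \<and> card P = k \<and> (\<forall>j\<in>P. subset.chain (Pow (X j)) (C j)) \<and>
    (\<forall>i\<in>{1..M} - P. D i \<subseteq> X i)"
  let ?H = "{F \<in> homogeneous_family M X I. (\<forall>j\<in>P. F \<inter> X j \<in> C j) \<and>
    (\<forall>i\<in>{1..M} - P. F \<inter> X i = D i)}"
  \<comment> \<open>The transversal condition is applied with the sizes of the prescribed traces as
    fixed coordinates.\<close>
  let ?J = "{v \<in> I. \<forall>j\<in>{1..M} - P. v j = card (D j)}"
  have "card ?H \<le> card ?J"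
  proof (rule card_inj_on_le[where f = "profile M X"])
    show "inj_on (profile M X) ?H"
    proof (rule inj_onI)
      fix F E assume F: "F \<in> ?H" and E: "E \<in> ?H" and eq: "profile M X F = profile M X E"
      show "F = E"
      proof (rule ground_subset_eqI[of F M X E])
        show "F \<subseteq> ground M X" "E \<subseteq> ground M X"
          using F E by (auto simp: homogeneous_family_def)
        fix i assume i: "i \<in> {1..M}"
        show "F \<inter> X i = E \<inter> X i"
        proof (cases "i \<in> P")
          case True
          have C: "subset.chain (Pow (X i)) (C i)" "F \<inter> X i \<in> C i" "E \<inter> X i \<in> C i"
            using P F E True by auto
          have "\<forall>A\<in>C i. \<forall>B\<in>C i. A \<subseteq> B \<or> B \<subseteq> A"
            using C(1) by (simp add: subset_chain_def)
          then have "F \<inter> X i \<subseteq> E \<inter> X i \<or> E \<inter> X i \<subseteq> F \<inter> X i"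
            using C(2,3) by metis
          moreover have "card (F \<inter> X i) = card (E \<inter> X i)"
            using profile_apply[OF i] eq by metis
          moreover have "finite (F \<inter> X i)" "finite (E \<inter> X i)" using fin[OF i] by auto
          ultimately show ?thesis using card_subset_eq by metis
        next
          case False
          then have "F \<inter> X i = D i" "E \<inter> X i = D i" using F E i by auto
          then show ?thesis by simp
        qed
      qed
    qed
    show "profile M X ` ?H \<subseteq> ?J"
      by (auto simp: homogeneous_family_def profile_def)
    show "finite ?J" using finite_subset[OF I finite_profile_space] by simp
  qed
  also have "card ?J \<le> L P"
  proof -
    have "\<forall>j\<in>{1..M} - P. card (D j) \<in> {0..<card (X j) + 1}"
      using P fin by (auto simp: less_Suc_eq_le intro!: card_mono)
    then show ?thesis
      using tr P by (simp add: transversal_def)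
  qed
  finally show "card ?H \<le> L P" .
qed

text \<open>Multiplicities are 0 or 1, so the maximum over a profile class is the indicator that the
  family meets it.\<close>

lemma Max_mult:
  assumes par: "parted M X" and \<F>: "\<F> \<subseteq> Pow (ground M X)" and v: "v \<in> profile_space M X"
  shows "Max {mult F \<F> | F. F \<in> Pow (ground M X) \<and> profile M X F = v} =
    (if v \<in> profile M X ` \<F> then 1 else 0)"
proof -
  let ?S = "{mult F \<F> | F. F \<in> Pow (ground M X) \<and> profile M X F = v}"
  have sub: "?S \<subseteq> {0, 1}" by (auto simp: mult_def)
  \<comment> \<open>The class is nonempty, so the maximum is over a nonempty set and 0 is attained
    when the family misses the class.\<close>
  obtain F where F: "F \<in> Pow (ground M X)" "profile M X F = v"
    by (rule profile_class_nonempty[OF par v])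
  show ?thesis
  proof (cases "v \<in> profile M X ` \<F>")
    case True
    then obtain E where E: "E \<in> \<F>" "profile M X E = v" by blast
    have "Max ?S = 1"
    proof (rule Max_eqI)
      show "finite ?S" using sub by (rule finite_subset) simp
      show "y \<le> 1" if "y \<in> ?S" for y using subsetD[OF sub that] by auto
      have "mult E \<F> = 1" using E(1) by (simp add: mult_def)
      then show "1 \<in> ?S" using E \<F> by (intro CollectI exI[of _ E]) auto
    qed
    then show ?thesis using True by simp
  next
    case False
    then have mult0: "mult E \<F> = 0" if "profile M X E = v" for E
      using that unfolding mult_def by auto
    have "Max ?S = 0"
    proof (rule Max_eqI)
      show "finite ?S" using sub by (rule finite_subset) simp
      show "y \<le> 0" if "y \<in> ?S" for y using that mult0 by auto
      show "0 \<in> ?S" using F mult0 by (intro CollectI exI[of _ F]) auto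
    qed
    then show ?thesis using False by simp
  qed
qed

text \<open>With the maxima being indicators, the constraint on a family depends only on the set of
  profiles that occur in it.\<close>

lemma family_satisfies_iff:
  assumes par: "parted M X" and \<F>: "\<F> \<subseteq> Pow (ground M X)"
  shows "family_satisfies M X \<Gamma> A \<alpha> \<F> \<longleftrightarrow> index_set_satisfies \<Gamma> A \<alpha> (profile M X ` \<F>)"
proof -
  have "(\<Sum>v\<in>profile_space M X.
      \<alpha> \<gamma> v * real (Max {mult F \<F> | F. F \<in> Pow (ground M X) \<and> profile M X F = v})) =
    (\<Sum>v\<in>profile M X ` \<F>. \<alpha> \<gamma> v)" for \<gamma>
  proof -
    have "(\<Sum>v\<in>profile_space M X.
        \<alpha> \<gamma> v * real (Max {mult F \<F> | F. F \<in> Pow (ground M X) \<and> profile M X F = v})) =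
      (\<Sum>v\<in>profile_space M X. if v \<in> profile M X ` \<F> then \<alpha> \<gamma> v else 0)"
      by (intro sum.cong refl) (simp only: Max_mult[OF assms], simp)
    also have "\<dots> = (\<Sum>v\<in>profile_space M X \<inter> profile M X ` \<F>. \<alpha> \<gamma> v)"
      by (rule sum.inter_restrict[symmetric]) (rule finite_profile_space)
    also have "profile_space M X \<inter> profile M X ` \<F> = profile M X ` \<F>"
      using profile_in_profile_space[OF par] by blast
    finally show ?thesis .
  qed
  then show ?thesis by (simp add: family_satisfies_def index_set_satisfies_def)
qed

text \<open>Nonnegative weights let the constraint descend to subsets, and so from a family to its
  traces on products of chains.\<close>

lemma index_set_satisfies_mono:
  assumes "multiplicity_constraint M X \<Gamma> A \<alpha>" "index_set_satisfies \<Gamma> A \<alpha> J"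
    and "I \<subseteq> J" "J \<subseteq> profile_space M X"
  shows "index_set_satisfies \<Gamma> A \<alpha> I"
  unfolding index_set_satisfies_def
proof
  fix \<gamma> assume \<gamma>: "\<gamma> \<in> \<Gamma>"
  have "(\<Sum>v\<in>I. \<alpha> \<gamma> v) \<le> (\<Sum>v\<in>J. \<alpha> \<gamma> v)"
    using assms \<gamma> finite_subset[OF assms(4) finite_profile_space]
    by (intro sum_mono2) (auto simp: multiplicity_constraint_def)
  then show "(\<Sum>v\<in>I. \<alpha> \<gamma> v) \<le> A \<gamma>"
    using assms(2) \<gamma> by (force simp: index_set_satisfies_def)
qed

lemma homogeneous_family_satisfies:
  assumes "parted M X" "I \<subseteq> profile_space M X"
  shows "family_satisfies M X \<Gamma> A \<alpha> (homogeneous_family M X I) \<longleftrightarrow> index_set_satisfies \<Gamma> A \<alpha> I"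
proof -
  have "homogeneous_family M X I \<subseteq> Pow (ground M X)" by (auto simp: homogeneous_family_def)
  then show ?thesis
    by (simp add: family_satisfies_iff[OF assms(1)] profile_image_homogeneous_family[OF assms])
qed

subsection \<open>Profile matrices\<close>

lemma profile_matrix_in_convex_hull:
  assumes par: "parted M X" and mc: "multiplicity_constraint M X \<Gamma> A \<alpha>"
    and sp: "sperner_family M X k L \<F>" and sat: "family_satisfies M X \<Gamma> A \<alpha> \<F>"
  shows "profile_matrix M X \<F> \<in> convex hull {profile_matrix M X (homogeneous_family M X I) | I.
    transversal M X k L I \<and> index_set_satisfies \<Gamma> A \<alpha> I}"
proof -
  obtain c and E :: "(nat \<Rightarrow> nat) \<Rightarrow> 'a set"
    where c: "\<And>i s t. i \<in> {1..M} \<Longrightarrow> s \<le> t \<Longrightarrow> c i s \<subseteq> c i t"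
      "\<And>i t. i \<in> {1..M} \<Longrightarrow> c i t \<subseteq> X i"
      "\<And>v i. i \<in> {1..M} \<Longrightarrow> E v \<inter> X i = c i (v i)"
    and E: "\<And>v. E v \<subseteq> ground M X"
      "\<And>v. v \<in> profile_space M X \<Longrightarrow> profile M X (E v) = v"
    by (rule product_chain_exists[OF par]) (rule that)
  have \<F>: "\<F> \<subseteq> Pow (ground M X)" using sp by (simp add: sperner_family_def)
  \<comment> \<open>\<open>I \<sigma>\<close> is the index set traced by \<open>\<F>\<close> on the
    product of chains moved by \<open>\<sigma>\<close>.\<close>
  define I where "I \<sigma> = {v \<in> profile_space M X. \<sigma> ` E v \<in> \<F>}" for \<sigma>
  define S where "S \<sigma> = profile_matrix M X (homogeneous_family M X (I \<sigma>))" for \<sigma>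
  let ?G = "part_perms M X"
  let ?H = "{profile_matrix M X (homogeneous_family M X I) | I.
    transversal M X k L I \<and> index_set_satisfies \<Gamma> A \<alpha> I}"
  have fin: "finite ?G" by (rule finite_part_perms[OF par])
  have pos: "real (card ?G) > 0" using fin id_in_part_perms[of M X] by (auto simp: card_gt_0_iff)
  have S: "S \<sigma> \<in> convex hull ?H" if \<sigma>: "\<sigma> \<in> ?G" for \<sigma>
  proof -
    have "transversal M X k L (I \<sigma>)"
      unfolding I_def by (rule trace_transversal[where c = c, OF par sp \<sigma> c E(2)])
    moreover have "I \<sigma> \<subseteq> profile M X ` \<F>"
    proof
      fix v assume "v \<in> I \<sigma>"
      then have "profile M X (\<sigma> ` E v) = v" "\<sigma> ` E v \<in> \<F>"
        using E(2) part_perms_profile[OF \<sigma>] by (auto simp: I_def)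
      then show "v \<in> profile M X ` \<F>" by (metis image_eqI)
    qed
    then have "index_set_satisfies \<Gamma> A \<alpha> (I \<sigma>)"
      by (rule index_set_satisfies_mono[OF mc iffD1[OF family_satisfies_iff[OF par \<F>] sat]])
        (intro image_subsetI profile_in_profile_space[OF par])
    ultimately have "S \<sigma> \<in> ?H" unfolding S_def by blast
    then show ?thesis by (rule hull_inc)
  qed
  \<comment> \<open>Uniform average over the group, compared entry by entry: at \<open>v\<close> it
    is the fraction of \<open>\<sigma>\<close> with \<open>v\<close> in \<open>I \<sigma>\<close>,
    times the size of the profile class. By \<open>card_hitting_ratio\<close> this is the number of
    members of \<open>\<F>\<close> with profile \<open>v\<close>.\<close>
  have "profile_matrix M X \<F> = (\<Sum>\<sigma>\<in>?G. (1 / real (card ?G)) *\<^sub>R S \<sigma>)"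
  proof (rule poly_mapping_eqI)
    fix v
    let ?p = "real (\<Prod>j\<in>{1..M}. card (X j) choose v j)"
    have "Poly_Mapping.lookup (S \<sigma>) v = (if v \<in> I \<sigma> then ?p else 0)" for \<sigma>
      unfolding S_def by (rule lookup_profile_matrix_homogeneous_family[OF par]) (auto simp: I_def)
    then have "Poly_Mapping.lookup (\<Sum>\<sigma>\<in>?G. (1 / real (card ?G)) *\<^sub>R S \<sigma>) v =
        (\<Sum>\<sigma>\<in>?G. if v \<in> I \<sigma> then ?p / real (card ?G) else 0)"
      by (simp only: lookup_sum lookup_scaleR) (intro sum.cong refl, simp)
    also have "\<dots> = (\<Sum>\<sigma>\<in>{\<sigma> \<in> ?G. v \<in> I \<sigma>}. ?p / real (card ?G))"
      by (rule sum.inter_filter[OF fin, symmetric])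
    also have "\<dots> = real (card {\<sigma> \<in> ?G. v \<in> I \<sigma>}) * ?p / real (card ?G)" by simp
    also have "\<dots> = Poly_Mapping.lookup (profile_matrix M X \<F>) v"
    proof (cases "v \<in> profile_space M X")
      case True
      then have "{\<sigma> \<in> ?G. v \<in> I \<sigma>} = {\<sigma> \<in> ?G. \<sigma> ` E v \<in> \<F>}" by (auto simp: I_def)
      then show ?thesis
        using card_hitting_ratio[OF par E(1)[of v] \<F>] True pos
        by (simp only: E(2)[OF True] lookup_profile_matrix if_True) simp
    next
      case False
      then show ?thesis by (simp add: I_def lookup_profile_matrix)
    qed
    finally show "Poly_Mapping.lookup (profile_matrix M X \<F>) v =
      Poly_Mapping.lookup (\<Sum>\<sigma>\<in>?G. (1 / real (card ?G)) *\<^sub>R S \<sigma>) v" by simp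
  qed
  also have "\<dots> \<in> convex hull ?H"
    using S pos by (intro convex_sum[OF fin convex_convex_hull]) auto
  finally show ?thesis .
qed

lemma sum_lookup_profile_matrix:
  assumes par: "parted M X" and \<F>: "\<F> \<subseteq> Pow (ground M X)"
  shows "(\<Sum>v\<in>profile_space M X. Poly_Mapping.lookup (profile_matrix M X \<F>) v) = real (card \<F>)"
proof -
  have fin: "finite \<F>" using finite_subset[OF \<F>] finite_ground[OF par] by simp
  have "profile M X ` \<F> \<subseteq> profile_space M X" using profile_in_profile_space[OF par] by blast
  from sum.group[OF fin finite_profile_space this, of "\<lambda>_. 1 :: nat"]
  have "card \<F> = (\<Sum>v\<in>profile_space M X. card {F \<in> \<F>. profile M X F = v})" by simp
  then show ?thesis by (simp add: lookup_profile_matrix)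
qed

text \<open>Each entry of a homogeneous matrix is 0 or the full class size \<open>c v\<close>. Hence
  the hull of \<open>T\<close> lies in the box with upper bounds \<open>c\<close>, and the given
  matrix is a vertex of that box.\<close>

lemma extreme_point_homogeneous:
  assumes par: "parted M X" and I: "I \<subseteq> profile_space M X"
    and mem: "profile_matrix M X (homogeneous_family M X I) \<in> convex hull T"
    and T: "T \<subseteq> {profile_matrix M X (homogeneous_family M X J) | J. J \<subseteq> profile_space M X}"
  shows "profile_matrix M X (homogeneous_family M X I) extreme_point_of (convex hull T)"
proof -
  define c where
    "c v = (if v \<in> profile_space M X then real (\<Prod>j\<in>{1..M}. card (X j) choose v j) else 0)" for v
  have vertex: "Poly_Mapping.lookup (profile_matrix M X (homogeneous_family M X J)) v \<in> {0, c v}"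
    if "J \<subseteq> profile_space M X" for J v
    using that by (auto simp: lookup_profile_matrix_homogeneous_family[OF par that] c_def)
  have c: "c v \<ge> 0" for v unfolding c_def by (auto intro: prod_nonneg)
  have "T \<subseteq> {x. \<forall>v. Poly_Mapping.lookup x v \<in> {0..c v}}"
  proof
    fix x assume "x \<in> T"
    then obtain J where "J \<subseteq> profile_space M X"
      and x: "x = profile_matrix M X (homogeneous_family M X J)"
      using T by blast
    then have "Poly_Mapping.lookup x v \<in> {0, c v}" for v using vertex by blast
    then have "Poly_Mapping.lookup x v \<in> {0..c v}" for v
      using c[of v] by (metis atLeastAtMost_iff insert_iff order_refl singletonD)
    then show "x \<in> {x. \<forall>v. Poly_Mapping.lookup x v \<in> {0..c v}}" by blast
  qed
  then have "convex hull T \<subseteq> {x. \<forall>v. Poly_Mapping.lookup x v \<in> {0..c v}}"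
    by (rule hull_minimal[where S = convex, OF _ convex_lookup_box])
  then have box: "Poly_Mapping.lookup y v \<in> {0..c v}" if "y \<in> convex hull T" for y v
    using that by blast
  show ?thesis
    unfolding extreme_point_of_def
  proof (intro conjI mem ballI)
    fix a b assume "a \<in> convex hull T" "b \<in> convex hull T"
    then show "profile_matrix M X (homogeneous_family M X I) \<notin> open_segment a b"
      using box vertex[OF I] by (intro box_vertex_not_in_open_segment[where c = c]) auto
  qed
qed

theorem theorem5p5:
  fixes M k :: nat and X :: "nat \<Rightarrow> 'a set" and L :: "nat set \<Rightarrow> nat"
    and \<Gamma> :: "'g set" and A :: "'g \<Rightarrow> real" and \<alpha> :: "'g \<Rightarrow> (nat \<Rightarrow> nat) \<Rightarrow> real"
  assumes "parted M X"
    and "k \<in> {1..M}"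
    and "\<And>P. P \<subseteq> {1..M} \<Longrightarrow> card P = k \<Longrightarrow> L P > 0"
    and "multiplicity_constraint M X \<Gamma> A \<alpha>"
  shows "{x. x extreme_point_of
              (convex hull {profile_matrix M X \<F> | \<F>.
                 sperner_family M X k L \<F> \<and> family_satisfies M X \<Gamma> A \<alpha> \<F>})}
         = {profile_matrix M X (homogeneous_family M X I) | I.
              transversal M X k L I \<and> index_set_satisfies \<Gamma> A \<alpha> I} \<and>
         (\<exists>\<H>. homogeneous M X \<H> \<and>
           sperner_family M X k L \<H> \<and> family_satisfies M X \<Gamma> A \<alpha> \<H> \<and>
           (\<forall>\<F>. sperner_family M X k L \<F> \<and> family_satisfies M X \<Gamma> A \<alpha> \<F> \<longrightarrow> card \<F> \<le> card \<H>))"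
proof -
  note par = assms(1) and mc = assms(4)
  let ?T = "{profile_matrix M X \<F> | \<F>.
    sperner_family M X k L \<F> \<and> family_satisfies M X \<Gamma> A \<alpha> \<F>}"
  let ?H = "{profile_matrix M X (homogeneous_family M X I) | I.
    transversal M X k L I \<and> index_set_satisfies \<Gamma> A \<alpha> I}"
  define Is where "Is = {I. transversal M X k L I \<and> index_set_satisfies \<Gamma> A \<alpha> I}"
  have Is: "I \<subseteq> profile_space M X" "sperner_family M X k L (homogeneous_family M X I)"
    "family_satisfies M X \<Gamma> A \<alpha> (homogeneous_family M X I)" if "I \<in> Is" for I
  proof -
    show I: "I \<subseteq> profile_space M X" using that by (simp add: Is_def transversal_def)
    show "sperner_family M X k L (homogeneous_family M X I)"
      using homogeneous_family_sperner[OF par] that by (simp add: Is_def)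
    show "family_satisfies M X \<Gamma> A \<alpha> (homogeneous_family M X I)"
      unfolding homogeneous_family_satisfies[OF par I] using that by (simp add: Is_def)
  qed
  have TH: "?T \<subseteq> convex hull ?H"
  proof
    fix x assume "x \<in> ?T"
    then obtain \<F> where "sperner_family M X k L \<F>" "family_satisfies M X \<Gamma> A \<alpha> \<F>"
      and "x = profile_matrix M X \<F>"
      by blast
    then show "x \<in> convex hull ?H" using profile_matrix_in_convex_hull[OF par mc] by simp
  qed
  \<comment> \<open>Homogeneous families over admissible transversals are themselves admissible,
    which gives the reverse inclusion of the hulls.\<close>
  have "?H \<subseteq> ?T" using Is unfolding Is_def by blast
  from hull_mono[where S = convex, OF this]
  have hull: "convex hull ?T = convex hull ?H"
    by (rule antisym[OF hull_minimal[where S = convex, OF TH convex_convex_hull]])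
  \<comment> \<open>Extreme points of a hull lie among its generators; conversely every generator is
    a vertex of the box.\<close>
  have "{x. x extreme_point_of (convex hull ?H)} = ?H"
  proof (rule antisym[OF extreme_points_of_convex_hull subsetI])
    fix x assume x: "x \<in> ?H"
    then obtain I where I: "I \<in> Is" "x = profile_matrix M X (homogeneous_family M X I)"
      by (auto simp: Is_def)
    have sub: "?H \<subseteq> {profile_matrix M X (homogeneous_family M X J) | J. J \<subseteq> profile_space M X}"
      using Is(1) unfolding Is_def by blast
    show "x \<in> {x. x extreme_point_of (convex hull ?H)}"
      unfolding I(2) mem_Collect_eq
      by (rule extreme_point_homogeneous[OF par Is(1)[OF I(1)] hull_inc[OF x[unfolded I(2)]] sub])
  qed
  moreover have "\<exists>\<H>. homogeneous M X \<H> \<and>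
      sperner_family M X k L \<H> \<and> family_satisfies M X \<Gamma> A \<alpha> \<H> \<and>
      (\<forall>\<F>. sperner_family M X k L \<F> \<and> family_satisfies M X \<Gamma> A \<alpha> \<F> \<longrightarrow> card \<F> \<le> card \<H>)"
  proof -
    let ?card = "\<lambda>J. card (homogeneous_family M X J)"
    have "Is \<subseteq> Pow (profile_space M X)" using Is(1) by blast
    then have "finite Is" using finite_profile_space by (metis finite_Pow_iff finite_subset)
    \<comment> \<open>Since \<open>A \<gamma> \<ge> 0\<close>, the empty index set is admissible, so
      the maximum of the sizes is over a nonempty finite set.\<close>
    moreover have "{} \<in> Is"
      using mc
      by (simp add: Is_def transversal_def index_set_satisfies_def multiplicity_constraint_def)
    ultimately have fin: "finite (?card ` Is)" and "?card ` Is \<noteq> {}" by auto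
    from Max_in[OF this] obtain I where I: "I \<in> Is" and "Max (?card ` Is) = ?card I" by auto
    then have max: "?card J \<le> ?card I" if "J \<in> Is" for J
      using Max_ge[OF fin imageI[OF that]] by simp
    \<comment> \<open>The half-space of matrices whose entry sum is at most the largest homogeneous
      size. It contains the generators, hence the hull, hence the matrix of every admissible
      family.\<close>
    let ?B = "{x. (\<Sum>v\<in>profile_space M X. Poly_Mapping.lookup x v) \<le>
      real (card (homogeneous_family M X I))}"
    have "?H \<subseteq> ?B"
    proof
      fix x assume "x \<in> ?H"
      then obtain J where J: "J \<in> Is" "x = profile_matrix M X (homogeneous_family M X J)"
        by (auto simp: Is_def)
      have "homogeneous_family M X J \<subseteq> Pow (ground M X)" by (auto simp: homogeneous_family_def)
      from sum_lookup_profile_matrix[OF par this] show "x \<in> ?B" using max[OF J(1)] J(2) by simp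
    qed
    then have "convex hull ?H \<subseteq> ?B" by (rule hull_minimal[where S = convex, OF _ convex_sum_lookup_le])
    then have le: "card \<F> \<le> card (homogeneous_family M X I)"
      if "sperner_family M X k L \<F>" "family_satisfies M X \<Gamma> A \<alpha> \<F>" for \<F>
    proof -
      have "profile_matrix M X \<F> \<in> ?B"
        using \<open>convex hull ?H \<subseteq> ?B\<close> TH that by blast
      moreover have "\<F> \<subseteq> Pow (ground M X)" using that(1) by (simp add: sperner_family_def)
      ultimately show ?thesis using sum_lookup_profile_matrix[OF par] by simp
    qed
    have "homogeneous M X (homogeneous_family M X I)"
      using Is(1)[OF I] by (auto simp: homogeneous_def)
    then show ?thesis using Is[OF I] le by blast
  qed
  ultimately show ?thesis unfolding hull by blast
qed

end
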